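(* Let $\mathcal{A}$ be a strongly connected $d$-dimensional VASS with at least one transition. If Algorithm 1 (described in the context) returns "non-terminating" on input $\mathcal{A}$, then $\mathcal{A}$ is non-terminating.
   Context: A $d$-dimensional VASS is a pair $\mathcal{A}=(Q,T)$ with $Q$ a finite nonempty set of states and $T\subseteq Q\times\mathbb{Z}^d\times Q$ a finite set of transitions such that every state has an outgoing transition. A configuration is $p\mathbf{v}$ with $p\in Q$, $\mathbf{v}\in\mathbb{N}^d$, of size $\max_i\mathbf{v}(i)$. A computation from $p_0\mathbf{v}_0$ is a sequence of configurations $p_0\mathbf{v}_0,\dots,p_n\mathbf{v}_n$ (vectors in $\mathbb{N}^d$) with transitions $(p_i,\mathbf{u}_{i+1},p_{i+1})\in T$ and $\mathbf{v}_{i+1}=\mathbf{v}_i+\mathbf{u}_{i+1}$; length $n$. $L(p\mathbf{v})\in\mathbb{N}\cup\{\infty\}$ is the least bound on lengths of computations from $p\mathbf{v}$; $\mathcal{L}(n)=\sup\{L(p\mathbf{v}):\text{size}(p\mathbf{v})=n\}$; $\mathcal{A}$ is non-terminating if $\mathcal{L}(n)=\infty$ for some $n$. A sub-VASS is a VASS $(Q',T')$ with $Q'\subseteq Q$, $T'\subseteq T$; strongly connected means a nonempty path between any two states; an SCC of a graph $(Q,T')$ is a maximal strongly connected sub-VASS of it. A linear map is $f(p\mathbf{v})=\mathbf{c}_f^\top\mathbf{v}+\mathbf{w}_f(p)$ with $\mathbf{c}_f\in\mathbb{Q}^d$, $\mathbf{w}_f\in\mathbb{Q}^Q$; a transition $(p,\mathbf{u},q)$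 is $f$-ranked if $\mathbf{c}_f^\top\mathbf{u}+\mathbf{w}_f(q)\le\mathbf{w}_f(p)-1$ and $f$-neutral if $\mathbf{c}_f^\top\mathbf{u}+\mathbf{w}_f(q)=\mathbf{w}_f(p)$. A QRF is a linear map with $\mathbf{c}_f\ge\vec0$ such that every transition is $f$-ranked or $f$-neutral; positive if $\mathbf{c}_f>\vec0$. Algorithm 1: set $\mathit{tight}:=\mathit{true}$ iff a positive QRF for $\mathcal{A}$ exists; $k:=\mathrm{Decompose}(\mathcal{A})$; if $k=\infty$ return "non-terminating", else return $(k,\mathit{tight})$. $\mathrm{Decompose}(\mathcal{A})$: pick a QRF $f$ maximizing the number of $f$-ranked transitions; $T_f:=$ set of $f$-neutral transitions; if $T_f$ contains all transitions return $\infty$; if $T_f=\emptyset$ return $1$; otherwise with $\mathcal{A}_1,\dots,\mathcal{A}_\ell$ all SCCs of $(Q,T_f)$ return $1+\max_i\mathrm{Decompose}(\mathcal{A}_i)$. *)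

theory Defs
  imports Complex_Main "HOL-Library.Extended_Nat" "HOL-Analysis.Finite_Cartesian_Product"
begin

text \<open>A pair of states and labelled transitions; it is a VASS only if \<open>is_vass\<close> holds. The raw type
  is also used for graphs such as \<open>(Q, T_f)\<close> in which some states may have no outgoing transition.\<close>

record ('q, 'd) vass =
  states :: "'q set"
  transitions :: "('q \<times> (int ^ 'd) \<times> 'q) set"

definition is_vass :: "('q, 'd::finite) vass \<Rightarrow> bool" where
  "is_vass A \<longleftrightarrow>
     finite (states A) \<and> states A \<noteq> {} \<and>
     finite (transitions A) \<and> transitions A \<subseteq> states A \<times> UNIV \<times> states A \<and>
     (\<forall>p\<in>states A. \<exists>u q. (p, u, q) \<in> transitions A)"

type_synonym ('q, 'd) config = "'q \<times> (nat ^ 'd)"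

definition config_size :: "('q, 'd::finite) config \<Rightarrow> nat" where
  "config_size c = Max (range (\<lambda>i. snd c $ i))"

definition step :: "('q, 'd::finite) vass \<Rightarrow> ('q, 'd) config \<Rightarrow> ('q, 'd) config \<Rightarrow> bool" where
  "step A c c' \<longleftrightarrow>
     (\<exists>u. (fst c, u, fst c') \<in> transitions A \<and> (\<forall>i. int (snd c' $ i) = int (snd c $ i) + u $ i))"

definition computation :: "('q, 'd::finite) vass \<Rightarrow> ('q, 'd) config list \<Rightarrow> bool" where
  "computation A cs \<longleftrightarrow>
     cs \<noteq> [] \<and> (\<forall>c\<in>set cs. fst c \<in> states A) \<and>
     (\<forall>i. Suc i < length cs \<longrightarrow> step A (cs ! i) (cs ! Suc i))"

text \<open>A computation with \<open>n + 1\<close> configurations has length \<open>n\<close>.\<close>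

definition max_length :: "('q, 'd::finite) vass \<Rightarrow> ('q, 'd) config \<Rightarrow> enat" where
  "max_length A c = Sup {enat (length cs - 1) | cs. computation A cs \<and> hd cs = c}"

definition termination_complexity :: "('q, 'd::finite) vass \<Rightarrow> nat \<Rightarrow> enat" where
  "termination_complexity A n =
     Sup {max_length A c | c. fst c \<in> states A \<and> config_size c = n}"

definition non_terminating :: "('q, 'd::finite) vass \<Rightarrow> bool" where
  "non_terminating A \<longleftrightarrow> (\<exists>n. termination_complexity A n = \<infinity>)"

definition sub_vass :: "('q, 'd::finite) vass \<Rightarrow> ('q, 'd) vass \<Rightarrow> bool" where
  "sub_vass B A \<longleftrightarrow> is_vass B \<and> states B \<subseteq> states A \<and> transitions B \<subseteq> transitions A"

definition strongly_connected :: "('q, 'd::finite) vass \<Rightarrow> bool" where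
  "strongly_connected A \<longleftrightarrow>
     (\<forall>p\<in>states A. \<forall>q\<in>states A. (p, q) \<in> {(r, s). \<exists>u. (r, u, s) \<in> transitions A}\<^sup>+)"

definition is_scc :: "('q, 'd::finite) vass \<Rightarrow> ('q, 'd) vass \<Rightarrow> bool" where
  "is_scc B G \<longleftrightarrow>
     sub_vass B G \<and> strongly_connected B \<and>
     (\<forall>C. sub_vass C G \<and> strongly_connected C \<and> sub_vass B C \<longrightarrow> C = B)"

text \<open>A linear map is given by its coefficients \<open>c\<close> and its state weights \<open>w\<close>; only the values of
  \<open>w\<close> on the states of the VASS matter.\<close>

type_synonym ('q, 'd) linear_map = "(rat ^ 'd) \<times> ('q \<Rightarrow> rat)"

definition coeff_dot :: "rat ^ 'd::finite \<Rightarrow> int ^ 'd \<Rightarrow> rat" where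
  "coeff_dot c u = (\<Sum>i\<in>UNIV. c $ i * of_int (u $ i))"

fun ranked :: "('q, 'd::finite) linear_map \<Rightarrow> 'q \<times> (int ^ 'd) \<times> 'q \<Rightarrow> bool" where
  "ranked (c, w) (p, u, q) \<longleftrightarrow> coeff_dot c u + w q \<le> w p - 1"

fun neutral :: "('q, 'd::finite) linear_map \<Rightarrow> 'q \<times> (int ^ 'd) \<times> 'q \<Rightarrow> bool" where
  "neutral (c, w) (p, u, q) \<longleftrightarrow> coeff_dot c u + w q = w p"

definition qrf :: "('q, 'd::finite) vass \<Rightarrow> ('q, 'd) linear_map \<Rightarrow> bool" where
  "qrf A f \<longleftrightarrow> (\<forall>i. 0 \<le> fst f $ i) \<and> (\<forall>t\<in>transitions A. ranked f t \<or> neutral f t)"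

definition positive_qrf :: "('q, 'd::finite) vass \<Rightarrow> ('q, 'd) linear_map \<Rightarrow> bool" where
  "positive_qrf A f \<longleftrightarrow> qrf A f \<and> (\<forall>i. 0 < fst f $ i)"

definition maximal_qrf :: "('q, 'd::finite) vass \<Rightarrow> ('q, 'd) linear_map \<Rightarrow> bool" where
  "maximal_qrf A f \<longleftrightarrow>
     qrf A f \<and>
     (\<forall>g. qrf A g \<longrightarrow> card {t \<in> transitions A. ranked g t} \<le> card {t \<in> transitions A. ranked f t})"

definition neutral_trans :: "('q, 'd::finite) vass \<Rightarrow> ('q, 'd) linear_map \<Rightarrow> ('q \<times> (int ^ 'd) \<times> 'q) set" where
  "neutral_trans A f = {t \<in> transitions A. neutral f t}"

definition sccs_of_neutral :: "('q, 'd::finite) vass \<Rightarrow> ('q, 'd) linear_map \<Rightarrow> ('q, 'd) vass set" where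
  "sccs_of_neutral A f = {B. is_scc B \<lparr>states = states A, transitions = neutral_trans A f\<rparr>}"

text \<open>\<open>decompose A k\<close>: some run of the procedure on \<open>A\<close> returns \<open>k\<close>, the choice of the maximizing
  QRF being left open at every recursive call. The maximum over the finitely many SCCs is written as
  a supremum in \<^typ>\<open>enat\<close>; an empty family of SCCs cannot arise for a maximizing QRF with \<open>T_f\<close> nonempty.\<close>

inductive decompose :: "('q, 'd::finite) vass \<Rightarrow> enat \<Rightarrow> bool" where
  all_neutral:
    "\<lbrakk>maximal_qrf A f; neutral_trans A f = transitions A\<rbrakk> \<Longrightarrow> decompose A \<infinity>"
| none_neutral:
    "\<lbrakk>maximal_qrf A f; neutral_trans A f \<noteq> transitions A; neutral_trans A f = {}\<rbrakk> \<Longrightarrow> decompose A 1"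
| recurse:
    "\<lbrakk>maximal_qrf A f; neutral_trans A f \<noteq> transitions A; neutral_trans A f \<noteq> {};
      \<forall>B\<in>sccs_of_neutral A f. decompose B (k B)\<rbrakk>
     \<Longrightarrow> decompose A (1 + (SUP B\<in>sccs_of_neutral A f. k B))"

datatype outcome = Non_Terminating | Degree nat bool

text \<open>\<open>algorithm1 A r\<close>: some run of the algorithm on \<open>A\<close> returns \<open>r\<close>; the Boolean component of
  \<open>Degree\<close> is the flag \<open>tight\<close>.\<close>

definition algorithm1 :: "('q, 'd::finite) vass \<Rightarrow> outcome \<Rightarrow> bool" where
  "algorithm1 A r \<longleftrightarrow>
     (\<exists>k. decompose A k \<and>
        r = (case k of \<infinity> \<Rightarrow> Non_Terminating | enat n \<Rightarrow> Degree n (\<exists>f. positive_qrf A f)))"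

end

theory Submission
  imports "Graph_Theory.Euler" Defs
begin

text \<open>
  If the algorithm answers ``non-terminating'', some strongly connected sub-VASS has only QRFs for
  which every transition is neutral. By Farkas' lemma, for each transition \<open>t\<close> the failure to rank
  \<open>t\<close> is witnessed by a nonnegative rational circulation that uses \<open>t\<close> and whose total effect is
  nonnegative. Summing these over all \<open>t\<close> and clearing denominators gives a positive integral
  circulation; by connectivity it is realised by an Eulerian circuit in the multigraph having that
  many copies of each transition. Since the effect of the circuit is nonnegative, it can be repeated
  forever from a sufficiently large initial vector.
\<close>

hide_const (open) Digraph_Component.strongly_connected

section \<open>Farkas' lemma over an ordered field\<close>

text \<open>One equation for additivity (\<open>r = 1\<close>) and homogeneity
  (\<open>x = 0\<close>), on plain functions, so that no vector space structure is needed.\<close>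

definition linear_functional :: "(('i \<Rightarrow> 'f::linordered_field) \<Rightarrow> 'f) \<Rightarrow> bool" where
  "linear_functional a \<longleftrightarrow> (\<forall>x y r. a (\<lambda>i. x i + r * y i) = a x + r * a y)"

lemma linear_functionalD:
  "linear_functional a \<Longrightarrow> a (\<lambda>i. x i + r * y i) = a x + r * a y"
  by (simp add: linear_functional_def)

text \<open>The bound at \<open>- x\<close> is the reverse bound at \<open>x\<close>. This is
  Farkas' lemma without constraints, the base of the induction below.\<close>

lemma linear_functional_nonpos_eq_0:
  assumes "linear_functional b" "\<And>x. b x \<le> 0"
  shows "b x = 0"
proof -
  have "b x = b x + 1 * b (\<lambda>_. 0)"
    using linear_functionalD[OF assms(1), of x 1 "\<lambda>_. 0"] by simp
  then have "b (\<lambda>_. 0) = 0" by simp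
  then have "b (\<lambda>i. - x i) = - b x"
    using linear_functionalD[OF assms(1), of "\<lambda>_. 0" "-1" x] by simp
  then show ?thesis using assms(2)[of x] assms(2)[of "\<lambda>i. - x i"] by simp
qed

text \<open>Bartl's induction on the number of constraints; no finite dimensionality is needed.\<close>

theorem farkas:
  fixes a :: "'j \<Rightarrow> ('i \<Rightarrow> 'f::linordered_field) \<Rightarrow> 'f"
  assumes "finite J" "\<And>j. j \<in> J \<Longrightarrow> linear_functional (a j)" "linear_functional b"
    and "\<And>x. \<forall>j\<in>J. a j x \<le> 0 \<Longrightarrow> b x \<le> 0"
  shows "\<exists>l. (\<forall>j\<in>J. 0 \<le> l j) \<and> (\<forall>x. b x = (\<Sum>j\<in>J. l j * a j x))"
  using assms
proof (induction J arbitrary: a b rule: finite_induct)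
  case empty
  then have "b x = 0" for x by (intro linear_functional_nonpos_eq_0) auto
  then show ?case by simp
next
  case (insert k J)
  show ?case
  proof (cases "\<forall>x. (\<forall>j\<in>J. a j x \<le> 0) \<longrightarrow> b x \<le> 0")
    \<comment> \<open>Constraint \<open>k\<close> is redundant and gets multiplier 0.\<close>
    case True
    then obtain l where l: "\<forall>j\<in>J. 0 \<le> l j" "\<forall>x. b x = (\<Sum>j\<in>J. l j * a j x)"
      using insert.IH[of a b] insert.prems by auto
    have "b x = (\<Sum>j\<in>insert k J. (l(k := 0)) j * a j x)" for x
      using l(2) insert.hyps by (auto intro!: sum.cong)
    moreover have "\<forall>j\<in>insert k J. 0 \<le> (l(k := 0)) j"
      using l(1) by auto
    ultimately show ?thesis by blast
  next
    case False
    then obtain z where z: "\<forall>j\<in>J. a j z \<le> 0" "b z > 0" by (auto simp: not_le)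
    \<comment> \<open>Otherwise \<open>z\<close> would satisfy all constraints and yet have
      \<open>b z > 0\<close>.\<close>
    with insert.prems(3)[of z] have akz: "a k z > 0" by force
    define s where "s x = - (a k x / a k z)" for x
    \<comment> \<open>Projecting along \<open>z\<close> onto the kernel of \<open>a k\<close> removes the constraint \<open>k\<close>.\<close>
    define a' where "a' j x = a j x + s x * a j z" for j x
    define b' where "b' x = b x + s x * b z" for x
    have proj: "a j (\<lambda>i. x i + s x * z i) = a' j x" if "j \<in> insert k J" for j x
      using linear_functionalD[OF insert.prems(1)[OF that]] by (simp add: a'_def)
    have projb: "b (\<lambda>i. x i + s x * z i) = b' x" for x
      using linear_functionalD[OF insert.prems(2)] by (simp add: b'_def)
    have s_lin: "s (\<lambda>i. x i + r * y i) = s x + r * s y" for x y r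
      using linear_functionalD[OF insert.prems(1), of k x r y]
      by (simp add: s_def add_divide_distrib)
    have "linear_functional (a' j)" if "j \<in> J" for j
      using linear_functionalD[OF insert.prems(1), of j] that
      by (simp add: linear_functional_def a'_def s_lin algebra_simps)
    moreover have "linear_functional b'"
      using linear_functionalD[OF insert.prems(2)]
      by (simp add: linear_functional_def b'_def s_lin algebra_simps)
    moreover have "b' x \<le> 0" if "\<forall>j\<in>J. a' j x \<le> 0" for x
    proof -
      have "a' k x = 0" using akz by (simp add: a'_def s_def)
      with that have "\<forall>j\<in>insert k J. a j (\<lambda>i. x i + s x * z i) \<le> 0"
        by (simp add: proj)
      then show ?thesis using insert.prems(3) projb by metis
    qed
    ultimately obtain l where l: "\<forall>j\<in>J. 0 \<le> l j" "\<And>x. b' x = (\<Sum>j\<in>J. l j * a' j x)"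
      using insert.IH[of a' b'] by blast
    \<comment> \<open>Undoing the projection leaves \<open>s x\<close> times the sum of
      \<open>l j * a j z\<close> minus \<open>s x * b z\<close>. As \<open>s x\<close> is
      \<open>- a k x / a k z\<close>, this is \<open>m * a k x\<close>.\<close>
    define m where "m = (b z - (\<Sum>j\<in>J. l j * a j z)) / a k z"
    have "(\<Sum>j\<in>J. l j * a j z) \<le> 0"
      using l(1) z(1) by (intro sum_nonpos) (simp add: mult_nonneg_nonpos)
    then have "0 \<le> m" using z(2) akz by (simp add: m_def)
    have "b x = (\<Sum>j\<in>J. l j * a j x) + m * a k x" for x
    proof -
      have "b x = (\<Sum>j\<in>J. l j * a' j x) - s x * b z"
        using l(2)[of x] by (simp add: b'_def)
      also have "(\<Sum>j\<in>J. l j * a' j x) = (\<Sum>j\<in>J. l j * a j x) + s x * (\<Sum>j\<in>J. l j * a j z)"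
        by (simp add: a'_def algebra_simps sum.distrib sum_distrib_left)
      also have "\<dots> - s x * b z = (\<Sum>j\<in>J. l j * a j x) + m * a k x"
        using akz by (simp add: s_def m_def field_simps)
      finally show ?thesis .
    qed
    then have "b x = (\<Sum>j\<in>insert k J. (l(k := m)) j * a j x)" for x
      using insert.hyps by (auto intro!: sum.cong)
    moreover have "\<forall>j\<in>insert k J. 0 \<le> (l(k := m)) j"
      using l(1) \<open>0 \<le> m\<close> by auto
    ultimately show ?thesis by blast
  qed
qed

section \<open>Rational circulations from Farkas' lemma\<close>

abbreviation src :: "'q \<times> 'u \<times> 'q \<Rightarrow> 'q" where "src t \<equiv> fst t"
abbreviation eff :: "'q \<times> 'u \<times> 'q \<Rightarrow> 'u" where "eff t \<equiv> fst (snd t)"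
abbreviation dst :: "'q \<times> 'u \<times> 'q \<Rightarrow> 'q" where "dst t \<equiv> snd (snd t)"

text \<open>The point \<open>y\<close> encodes a linear map: \<open>Inl\<close> indexes the coefficients, \<open>Inr\<close> the state weights.\<close>

definition drift :: "'q \<times> (int ^ 'd::finite) \<times> 'q \<Rightarrow> ('d + 'q \<Rightarrow> rat) \<Rightarrow> rat" where
  "drift t y = (\<Sum>i\<in>UNIV. y (Inl i) * of_int (eff t $ i)) + y (Inr (dst t)) - y (Inr (src t))"

lemma linear_functional_drift: "linear_functional (drift t)"
  by (simp add: linear_functional_def drift_def algebra_simps sum.distrib sum_distrib_left)

text \<open>Only finitely many drifts are negative, so a positive multiple of \<open>y\<close>
  pushes each of them to -1 or below. That multiple is a QRF, hence neutral everywhere.\<close>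

lemma drift_eq_0_if_all_qrf_neutral:
  assumes fin: "finite (transitions A)"
    and neutral: "\<And>g. qrf A g \<Longrightarrow> \<forall>t\<in>transitions A. neutral g t"
    and y: "\<And>i. 0 \<le> y (Inl i)" "\<And>t. t \<in> transitions A \<Longrightarrow> drift t y \<le> 0"
    and t: "t \<in> transitions A"
  shows "drift t y = 0"
proof -
  define N where "N = {t \<in> transitions A. drift t y < 0}"
  \<comment> \<open>\<open>r\<close> dominates each \<open>1 / - drift t y\<close> with
    \<open>t\<close> in \<open>N\<close>; the summand 1 keeps it positive when \<open>N\<close> is
    empty.\<close>
  define r where "r = 1 + (\<Sum>t\<in>N. 1 / - drift t y)"
  have "finite N" using fin by (simp add: N_def)
  have nn: "0 \<le> 1 / - drift t y" if "t \<in> N" for t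
    using that by (simp add: N_def divide_nonneg_neg)
  have "0 \<le> (\<Sum>t\<in>N. 1 / - drift t y)" using nn by (rule sum_nonneg)
  then have "r > 0" unfolding r_def by linarith
  have r_drift: "r * drift t y \<le> - 1" if "t \<in> N" for t
  proof -
    have "1 / - drift t y \<le> r"
      using member_le_sum[of t N "\<lambda>t. 1 / - drift t y"] nn \<open>finite N\<close> that by (simp add: r_def)
    then show ?thesis using that by (simp add: N_def field_simps)
  qed
  define g :: "(rat ^ 'b) \<times> ('a \<Rightarrow> rat)"
    where "g = (\<chi> i. r * y (Inl i), \<lambda>q. r * y (Inr q))"
  have change: "coeff_dot (fst g) u + snd g q - snd g p = r * drift (p, u, q) y" for p u q
    by (simp add: g_def coeff_dot_def drift_def algebra_simps sum_distrib_left)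
  have neutral_iff: "neutral g t \<longleftrightarrow> r * drift t y = 0" for t
    using change[of "eff t" "dst t" "src t"] by (cases g; cases t) auto
  have ranked_iff: "ranked g t \<longleftrightarrow> r * drift t y \<le> - 1" for t
    using change[of "eff t" "dst t" "src t"] by (cases g; cases t) auto
  have "qrf A g"
    unfolding qrf_def
  proof (intro conjI allI ballI)
    show "0 \<le> fst g $ i" for i using y(1) \<open>r > 0\<close> by (simp add: g_def)
    show "ranked g t \<or> neutral g t" if "t \<in> transitions A" for t
      using r_drift[of t] y(2)[OF that] that
      unfolding ranked_iff neutral_iff N_def by fastforce
  qed
  then have "neutral g t" using neutral t by blast
  then show ?thesis using \<open>r > 0\<close> by (simp add: neutral_iff)
qed

text \<open>Nonnegative coefficients and nonpositive drifts force
  \<open>- drift s y \<le> 0\<close>. The Farkas multipliers of this implication are the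
  circulation.\<close>

lemma ex_nonneg_multicycle_through:
  fixes A :: "('q, 'd::finite) vass"
  assumes fin: "finite (transitions A)"
    and neutral: "\<And>g. qrf A g \<Longrightarrow> \<forall>t\<in>transitions A. neutral g t"
    and s: "s \<in> transitions A"
  shows "\<exists>x :: 'q \<times> (int ^ 'd) \<times> 'q \<Rightarrow> rat. (\<forall>t\<in>transitions A. 0 \<le> x t) \<and> 1 \<le> x s \<and>
    (\<forall>i. 0 \<le> (\<Sum>t\<in>transitions A. x t * of_int (eff t $ i))) \<and>
    (\<forall>q. (\<Sum>t\<in>transitions A. x t * (of_bool (dst t = q) - of_bool (src t = q))) = 0)"
proof -
  let ?T = "transitions A"
  define a where "a j = (case j of Inl t \<Rightarrow> drift t | Inr i \<Rightarrow> \<lambda>y. - y (Inl i))"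
    for j :: "('q \<times> (int ^ 'd) \<times> 'q) + 'd"
  have lin: "linear_functional (a j)" for j
    using linear_functional_drift 
    by (cases j) (simp_all add: a_def linear_functional_def[of "\<lambda>y. - y (Inl _)"])
  have lin': "linear_functional (\<lambda>y. - drift s y)"
    using linear_functional_drift[of s] by (simp add: linear_functional_def)
  have imp: "- drift s y \<le> 0" if "\<forall>j \<in> ?T <+> UNIV. a j y \<le> 0" for y
  proof -
    have "0 \<le> y (Inl i)" for i using that by (auto simp: a_def dest: bspec[of _ _ "Inr i"])
    moreover have "drift t y \<le> 0" if "t \<in> ?T" for t
      using \<open>\<forall>j \<in> ?T <+> UNIV. a j y \<le> 0\<close> that by (auto simp: a_def dest: bspec[of _ _ "Inl t"])
    ultimately show ?thesis using drift_eq_0_if_all_qrf_neutral[OF fin neutral _ _ s] by simp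
  qed
  obtain l where l: "\<forall>j \<in> ?T <+> UNIV. 0 \<le> l j"
      "\<And>y. - drift s y = (\<Sum>j \<in> ?T <+> UNIV. l j * a j y)"
    using farkas[of "?T <+> UNIV" a "\<lambda>y. - drift s y", OF finite_Plus[OF fin finite] lin lin' imp]
    by blast
  \<comment> \<open>Moving \<open>- drift s y\<close> to the other side adds one to the multiplier
    of \<open>s\<close>, whence \<open>1 \<le> x s\<close>.\<close>
  define x where "x t = l (Inl t) + of_bool (t = s)" for t
  have "(\<Sum>t\<in>?T. of_bool (t = s) * drift t y) = drift s y" for y
    using fin s by (simp add: of_bool_def if_distrib[of "\<lambda>x. x * _"] cong: if_cong)
  then have eq: "(\<Sum>t\<in>?T. x t * drift t y) = (\<Sum>i\<in>UNIV. l (Inr i) * y (Inl i))" for y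
    using l(2)[of y] fin
    by (simp add: sum.Plus a_def x_def distrib_right sum.distrib sum_negf)
  have nonneg: "0 \<le> l (Inl t)" if "t \<in> ?T" for t
    using l(1) that by blast
  have "0 \<le> (\<Sum>t\<in>?T. x t * of_int (eff t $ i))" for i
  proof -
    \<comment> \<open>At the unit point of coefficient \<open>i\<close>, \<open>eq\<close> equates
      the total effect in \<open>i\<close> with the multiplier of
      \<open>- y (Inl i) \<le> 0\<close>.\<close>
    have "drift t (case_sum (\<lambda>j. of_bool (j = i)) (\<lambda>_. 0)) = of_int (eff t $ i)" for t :: "'q \<times> (int ^ 'd) \<times> 'q"
      by (simp add: drift_def of_bool_def if_distrib[of "\<lambda>x. x * _"] cong: if_cong)
    then show ?thesis
      using eq[of "case_sum (\<lambda>j. of_bool (j = i)) (\<lambda>_. 0)"] bspec[OF l(1) InrI[OF UNIV_I, of i]]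
      by (simp add: of_bool_def if_distrib[of "\<lambda>x. _ * x"] cong: if_cong)
  qed
  moreover have "(\<Sum>t\<in>?T. x t * (of_bool (dst t = q) - of_bool (src t = q))) = 0" for q
    \<comment> \<open>At the unit point of the weight of \<open>q\<close> the right side of
      \<open>eq\<close> vanishes, which is flow conservation at \<open>q\<close>.\<close>
    using eq[of "case_sum (\<lambda>_. 0) (\<lambda>p. of_bool (p = q))"] by (simp add: drift_def)
  moreover have "\<forall>t\<in>?T. 0 \<le> x t" "1 \<le> x s"
    using nonneg s by (simp_all add: x_def)
  ultimately show ?thesis by blast
qed

text \<open>Effect and flow conditions survive addition. In the sum of the circulations for all
  \<open>s\<close>, each transition gets at least 1 from its own and nothing negative from the
  others.\<close>

lemma ex_positive_multicycle:
  assumes fin: "finite (transitions A)"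
    and neutral: "\<And>g. qrf A g \<Longrightarrow> \<forall>t\<in>transitions A. neutral g t"
  shows "\<exists>x :: _ \<Rightarrow> rat. (\<forall>t\<in>transitions A. 1 \<le> x t) \<and>
    (\<forall>i. 0 \<le> (\<Sum>t\<in>transitions A. x t * of_int (eff t $ i))) \<and>
    (\<forall>q. (\<Sum>t\<in>transitions A. x t * (of_bool (dst t = q) - of_bool (src t = q))) = 0)"
proof -
  let ?T = "transitions A"
  define P where "P s x \<longleftrightarrow> (\<forall>t\<in>?T. 0 \<le> x t) \<and> 1 \<le> x s \<and>
    (\<forall>i. 0 \<le> (\<Sum>t\<in>?T. x t * of_int (eff t $ i))) \<and>
    (\<forall>q. (\<Sum>t\<in>?T. x t * (of_bool (dst t = q) - of_bool (src t = q))) = 0)"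
    for s and x :: "_ \<Rightarrow> rat"
  have "\<forall>s\<in>?T. \<exists>x. P s x"
    unfolding P_def using ex_nonneg_multicycle_through[OF fin neutral] by blast
  from bchoice[OF this] obtain X where X: "\<forall>s\<in>?T. P s (X s)" ..
  note X = X[unfolded P_def]
  define x where "x t = (\<Sum>s\<in>?T. X s t)" for t
  have swap: "(\<Sum>t\<in>?T. x t * h t) = (\<Sum>s\<in>?T. \<Sum>t\<in>?T. X s t * h t)" for h
    by (simp add: x_def sum_distrib_right) (rule sum.swap)
  have "1 \<le> x t" if "t \<in> ?T" for t
    using member_le_sum[of t ?T "\<lambda>s. X s t"] X that fin unfolding x_def by fastforce
  moreover have "0 \<le> (\<Sum>t\<in>?T. x t * of_int (eff t $ i))" for i
    unfolding swap using X by (blast intro: sum_nonneg[of ?T "\<lambda>s. \<Sum>t\<in>?T. X s t * of_int (eff t $ i)"])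
  moreover have "(\<Sum>t\<in>?T. x t * (of_bool (dst t = q) - of_bool (src t = q))) = 0" for q
    unfolding swap using X by (intro sum.neutral) blast
  ultimately show ?thesis by blast
qed

section \<open>Clearing denominators\<close>

lemma ex_common_denominator:
  assumes "finite S"
  shows "\<exists>N::nat. 0 < N \<and> (\<forall>t\<in>S. (x t :: rat) * of_nat N \<in> \<int>)"
  using assms
proof (induction S rule: finite_induct)
  case empty
  then show ?case by auto
next
  case (insert t S)
  then obtain N where N: "0 < N" "\<forall>t\<in>S. x t * of_nat N \<in> \<int>" by auto
  obtain a b where "quotient_of (x t) = (a, b)" by fastforce
  then have ab: "b > 0" "x t = of_int a / of_int b"
    by (auto simp: quotient_of_denom_pos quotient_of_div)
  have "x t * of_nat (N * nat b) = of_int (a * int N)"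
    using ab by simp
  moreover have "x s * of_nat (N * nat b) \<in> \<int>" if "s \<in> S" for s
  proof -
    have "x s * of_nat (N * nat b) = x s * of_nat N * of_nat (nat b)"
      by (simp add: mult.assoc)
    then show ?thesis using N(2) that by (metis Ints_mult Ints_of_nat)
  qed
  ultimately show ?case using N(1) ab(1)
    by (intro exI[of _ "N * nat b"]) (auto simp del: of_nat_mult)
qed

text \<open>Scaling by a common denominator preserves all conditions. Flow conservation becomes an
  equation of two sums, since subtraction on \<open>nat\<close> truncates.\<close>

lemma ex_integral_multicycle:
  assumes fin: "finite (transitions A)"
    and neutral: "\<And>g. qrf A g \<Longrightarrow> \<forall>t\<in>transitions A. neutral g t"
  shows "\<exists>x :: _ \<Rightarrow> nat. (\<forall>t\<in>transitions A. 1 \<le> x t) \<and>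
    (\<forall>i. 0 \<le> (\<Sum>t\<in>transitions A. int (x t) * (eff t $ i))) \<and>
    (\<forall>q. (\<Sum>t\<in>transitions A. x t * of_bool (dst t = q)) =
         (\<Sum>t\<in>transitions A. x t * of_bool (src t = q)))"
proof -
  let ?T = "transitions A"
  obtain x :: "_ \<Rightarrow> rat" where x: "\<And>t. t \<in> ?T \<Longrightarrow> 1 \<le> x t"
    "\<And>i. 0 \<le> (\<Sum>t\<in>?T. x t * of_int (eff t $ i))"
    "\<And>q. (\<Sum>t\<in>?T. x t * (of_bool (dst t = q) - of_bool (src t = q))) = 0"
    using ex_positive_multicycle[OF fin neutral] by blast
  obtain N :: nat where N: "0 < N" "\<And>t. t \<in> ?T \<Longrightarrow> x t * of_nat N \<in> \<int>"
    using ex_common_denominator[OF fin] by blast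
  \<comment> \<open>The argument is a nonnegative integer for every transition, so
    \<open>floor\<close> and \<open>nat\<close> lose nothing.\<close>
  define n where "n t = nat \<lfloor>x t * of_nat N\<rfloor>" for t
  have n: "(of_nat (n t) :: rat) = x t * of_nat N" if t: "t \<in> ?T" for t
  proof -
    have "0 \<le> x t * of_nat N" using x(1)[OF t] by (intro mult_nonneg_nonneg) auto
    moreover obtain z where "x t * of_nat N = of_int z" using N(2)[OF t] by (auto elim: Ints_cases)
    ultimately show ?thesis by (simp add: n_def)
  qed
  have scale: "(\<Sum>t\<in>?T. of_nat (n t) * h t) = of_nat N * (\<Sum>t\<in>?T. x t * h t)" for h :: "_ \<Rightarrow> rat"
    by (simp add: n sum_distrib_left mult_ac)
  have "1 \<le> n t" if "t \<in> ?T" for t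
  proof -
    have "0 < x t * of_nat N" using x(1)[OF that] N(1) by (intro mult_pos_pos) auto
    then show ?thesis using n[OF that] by (metis of_nat_0_less_iff less_eq_Suc_le One_nat_def)
  qed
  moreover have "0 \<le> (\<Sum>t\<in>?T. int (n t) * (eff t $ i))" for i
  proof -
    have "rat_of_int (\<Sum>t\<in>?T. int (n t) * (eff t $ i)) = of_nat N * (\<Sum>t\<in>?T. x t * of_int (eff t $ i))"
      using scale[of "\<lambda>t. of_int (eff t $ i)"] by simp
    also have "\<dots> \<ge> 0" using x(2) by simp
    finally show ?thesis by (simp only: of_int_0_le_iff)
  qed
  moreover have "(\<Sum>t\<in>?T. n t * of_bool (dst t = q)) = (\<Sum>t\<in>?T. n t * of_bool (src t = q))" for q
  proof -
    have "(\<Sum>t\<in>?T. of_nat (n t) * (of_bool (dst t = q) - of_bool (src t = q) :: rat)) = 0"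
      unfolding scale x(3) by simp
    then have "rat_of_nat (\<Sum>t\<in>?T. n t * of_bool (dst t = q)) = of_nat (\<Sum>t\<in>?T. n t * of_bool (src t = q))"
      by (simp add: right_diff_distrib sum_subtractf)
    then show ?thesis by (simp only: of_nat_eq_iff)
  qed
  ultimately show ?thesis by blast
qed

section \<open>Realising a circulation by an Eulerian circuit\<close>

lemma (in pre_digraph) cas_nth:
  assumes "cas u p v" "i < length p"
  shows "head G (p ! i) = (if Suc i = length p then v else tail G (p ! Suc i))"
  using assms
proof (induction p arbitrary: u i)
  case (Cons e p)
  then show ?case by (cases i; cases p) auto
qed simp

text \<open>\<open>connected\<close> refers to the symmetric closure of the arcs, which contains
  every directed path.\<close>

lemma (in wf_digraph) connected_if_trancl:
  assumes "verts G \<noteq> {}" "\<And>u v. u \<in> verts G \<Longrightarrow> v \<in> verts G \<Longrightarrow> u \<rightarrow>\<^sup>+ v"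
  shows "connected G"
proof -
  have "(u, v) \<in> rtrancl_on (verts G) ((arcs_ends G)\<^sup>s)" if "u \<in> verts G" "v \<in> verts G" for u v
  proof -
    have "(u, v) \<in> rtrancl_on (verts G) (arcs_ends G)"
      using assms(2)[OF that] reachable_def by (metis reachable1_reachable)
    then show ?thesis by (rule rtrancl_on_mono[rotated 2]) (auto simp: symcl_def)
  qed
  then show ?thesis using assms(1) by (simp add: connected_conv)
qed

text \<open>In the multigraph with \<open>x t\<close> copies of each \<open>t\<close>, balance says
  that in- and out-degrees agree. An Eulerian circuit uses every copy exactly once, so sums along it
  are sums weighted by \<open>x\<close>.\<close>

lemma ex_closed_walk:
  assumes A: "is_vass A" "strongly_connected A"
    and x: "\<And>t. t \<in> transitions A \<Longrightarrow> 1 \<le> (x t :: nat)"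
    and balanced: "\<And>q. (\<Sum>t\<in>transitions A. x t * of_bool (dst t = q)) =
         (\<Sum>t\<in>transitions A. x t * of_bool (src t = q))"
  shows "\<exists>ts. ts \<noteq> [] \<and> set ts \<subseteq> transitions A \<and>
    (\<forall>i < length ts. dst (ts ! i) = src (ts ! (Suc i mod length ts))) \<and>
    (\<forall>h :: _ \<Rightarrow> int. (\<Sum>i<length ts. h (ts ! i)) = (\<Sum>t\<in>transitions A. int (x t) * h t))"
proof -
  let ?T = "transitions A"
  define G where "G = \<lparr>verts = states A, arcs = Sigma ?T (\<lambda>t. {..<x t}),
    tail = \<lambda>e. src (fst e), head = \<lambda>e. dst (fst e)\<rparr>"
  have G_simps: "verts G = states A" "arcs G = Sigma ?T (\<lambda>t. {..<x t})"
    "\<And>e. tail G e = src (fst e)" "\<And>e. head G e = dst (fst e)"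
    by (simp_all add: G_def)
  have fin: "finite ?T" "finite (states A)" and wf: "?T \<subseteq> states A \<times> UNIV \<times> states A"
    and ne: "states A \<noteq> {}" and out: "\<And>p. p \<in> states A \<Longrightarrow> \<exists>u q. (p, u, q) \<in> ?T"
    using A(1) by (auto simp: is_vass_def)
  interpret fin_digraph G
    using wf fin by unfold_locales (auto simp: G_simps)
  \<comment> \<open>Copy 0 exists because \<open>x t\<close> is at least 1; the multigraph thus
    inherits connectivity from \<open>A\<close>.\<close>
  have copy: "(t, 0) \<in> arcs G" if "t \<in> ?T" for t
    using x[OF that] that by (auto simp: G_simps)
  have "arcs_ends G = {(r, s). \<exists>u. (r, u, s) \<in> ?T}"
    using copy by (force simp: arcs_ends_conv G_simps)
  then have conn: "connected G"
    using A(2) ne by (intro connected_if_trancl) (auto simp: G_simps strongly_connected_def)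
  have card_arcs: "card {e \<in> arcs G. P (fst e)} = (\<Sum>t\<in>?T. x t * of_bool (P t))" for P
  proof -
    have "{e \<in> arcs G. P (fst e)} = Sigma ?T (\<lambda>t. if P t then {..<x t} else {})"
      by (auto simp: G_simps split: if_splits)
    then show ?thesis using fin(1) by (simp add: card_SigmaI of_bool_def if_distrib cong: if_cong)
  qed
  have "in_degree G q = out_degree G q" for q
    using card_arcs[of "\<lambda>t. dst t = q"] card_arcs[of "\<lambda>t. src t = q"] balanced[of q]
    by (simp add: in_degree_def out_degree_def in_arcs_def out_arcs_def G_simps)
  then obtain u p where "euler_trail u p u"
    using closed_euler1[OF conn] by blast
  then have p: "cas u p u" "distinct p" "set p = arcs G"
    by (auto simp: euler_trail_def trail_def awalk_def)
  have "p \<noteq> []" using p(3) ne out copy by force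
  have tail_hd: "tail G (p ! 0) = u" using p(1) \<open>p \<noteq> []\<close> by (cases p) auto
  define ts where "ts = map fst p"
  have "dst (ts ! i) = src (ts ! (Suc i mod length ts))" if "i < length ts" for i
  proof -
    have "Suc i mod length p < length p" using \<open>p \<noteq> []\<close> by simp
    then show ?thesis
      using cas_nth[OF p(1), of i] that tail_hd
      \<comment> \<open>The last arc ends in \<open>u\<close>, the tail of the first; there the
        index modulo the length wraps to 0.\<close>
      by (cases "Suc i = length p") (auto simp: ts_def G_simps)
  qed
  moreover have "(\<Sum>i<length ts. h (ts ! i)) = (\<Sum>t\<in>?T. int (x t) * h t)" for h :: "_ \<Rightarrow> int"
  proof -
    have "(\<Sum>i<length ts. h (ts ! i)) = (\<Sum>i<length p. h (fst (p ! i)))"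
      by (simp add: ts_def)
    \<comment> \<open>As \<open>p\<close> is distinct with set \<open>arcs G\<close>, its positions
      enumerate the arcs bijectively.\<close>
    also have "\<dots> = (\<Sum>e\<in>arcs G. h (fst e))"
      using sum.reindex_bij_betw[OF bij_betw_nth[OF p(2) refl p(3)[symmetric]]] .
    also have "\<dots> = (\<Sum>t\<in>?T. \<Sum>k<x t. h t)"
      using fin(1) by (subst sum.Sigma) (simp_all add: G_simps split_def)
    finally show ?thesis by simp
  qed
  moreover have "ts \<noteq> []" "set ts \<subseteq> ?T"
    using \<open>p \<noteq> []\<close> by (simp_all add: ts_def p(3) G_simps image_subset_iff)
  ultimately show ?thesis by blast
qed

section \<open>Infinite runs\<close>

text \<open>The prefixes of one infinite run give computations of every length from
  \<open>c 0\<close>.\<close>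

lemma non_terminatingI:
  fixes c :: "nat \<Rightarrow> ('q, 'd::finite) config"
  assumes "\<And>j. fst (c j) \<in> states A" "\<And>j. step A (c j) (c (Suc j))"
  shows "non_terminating A"
proof -
  have "enat m \<le> max_length A (c 0)" for m
  proof -
    let ?cs = "map c [0..<Suc m]"
    have "computation A ?cs"
      using assms by (auto simp: computation_def simp del: upt_Suc)
    moreover have "hd ?cs = c 0" by (simp add: hd_map del: upt_Suc)
    moreover have "length ?cs - 1 = m" by simp
    ultimately have "enat m \<in> {enat (length cs - 1) | cs. computation A cs \<and> hd cs = c 0}"
      by (metis (mono_tags, lifting) mem_Collect_eq)
    then show ?thesis unfolding max_length_def by (rule Sup_upper)
  qed
  moreover have "max_length A (c 0) \<le> termination_complexity A (config_size (c 0))"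
    unfolding termination_complexity_def using assms(1) by (intro Sup_upper) blast
  ultimately have "enat m \<le> termination_complexity A (config_size (c 0))" for m
    using order_trans by blast
  then have "termination_complexity A (config_size (c 0)) = \<infinity>"
    by (metis enat_ord_simps(1) not_less_eq_eq order_refl not_infinity_eq)
  then show ?thesis unfolding non_terminating_def by blast
qed

text \<open>Separates the complete rounds of a repeated walk from the unfinished one.\<close>

lemma sum_periodic:
  fixes h :: "nat \<Rightarrow> int"
  shows "(\<Sum>k<j. h (k mod n)) = int (j div n) * (\<Sum>k<n. h k) + (\<Sum>k<j mod n. h k)"
proof (induction j)
  case (Suc j)
  show ?case
  \<comment> \<open>The case where step \<open>j\<close> completes a round.\<close>
  proof (cases "Suc (j mod n) = n")
    case True
    then have "Suc j mod n = 0" "Suc j div n = Suc (j div n)"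
      by (simp_all add: mod_Suc div_Suc)
    moreover have "(\<Sum>k<n. h k) = (\<Sum>k<j mod n. h k) + h (j mod n)"
      using True by (metis sum.lessThan_Suc)
    ultimately show ?thesis using Suc.IH by (simp add: algebra_simps)
  next
    case False
    then show ?thesis using Suc.IH by (simp add: mod_Suc div_Suc)
  qed
qed simp

text \<open>Complete rounds never decrease a counter, so only the loss within one unfinished round
  must be covered initially.\<close>

lemma non_terminating_if_closed_walk:
  assumes wf: "transitions A \<subseteq> states A \<times> UNIV \<times> states A"
    and ts: "ts \<noteq> []" "set ts \<subseteq> transitions A"
    and closed: "\<And>i. i < length ts \<Longrightarrow> dst (ts ! i) = src (ts ! (Suc i mod length ts))"
    and nonneg: "\<And>i. 0 \<le> (\<Sum>k<length ts. eff (ts ! k) $ i)"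
  shows "non_terminating (A :: ('q, 'd::finite) vass)"
proof -
  let ?n = "length ts"
  \<comment> \<open>The sum of absolute effects bounds the loss of any prefix of a round.\<close>
  define start where "start i = (\<Sum>k<?n. \<bar>eff (ts ! k) $ i\<bar>)" for i
  define v where "v j i = start i + (\<Sum>k<j. eff (ts ! (k mod ?n)) $ i)" for j i
  have v_nonneg: "0 \<le> v j i" for i j
  proof -
    have "(\<Sum>k<j mod ?n. - (eff (ts ! k) $ i)) \<le> (\<Sum>k<j mod ?n. \<bar>eff (ts ! k) $ i\<bar>)"
      by (intro sum_mono) simp
    also have "\<dots> \<le> start i"
      using ts(1) unfolding start_def
      by (intro sum_mono2) (auto intro: less_le_trans mod_le_divisor less_imp_le)
    finally show ?thesis
      using mult_nonneg_nonneg[OF of_nat_0_le_iff nonneg[of i], of "j div ?n"]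
      by (simp add: v_def sum_periodic[of "\<lambda>k. eff (ts ! k) $ i"] sum_negf)
  qed
  define c :: "nat \<Rightarrow> ('q, 'd) config"
    where "c j = (src (ts ! (j mod ?n)), \<chi> i. nat (v j i))" for j
  have in_T: "ts ! (j mod ?n) \<in> transitions A" for j
    using ts by (meson length_greater_0_conv mod_less_divisor nth_mem subsetD)
  have "fst (c j) \<in> states A" for j
    using in_T[of j] wf by (auto simp: c_def)
  moreover have "step A (c j) (c (Suc j))" for j
  proof -
    have "src (ts ! (Suc j mod ?n)) = dst (ts ! (j mod ?n))"
      using closed[of "j mod ?n"] ts(1) by (simp add: mod_Suc_eq)
    then have "(fst (c j), eff (ts ! (j mod ?n)), fst (c (Suc j))) \<in> transitions A"
      using in_T[of j] by (simp add: c_def)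
    moreover have "int (snd (c (Suc j)) $ i) = int (snd (c j) $ i) + eff (ts ! (j mod ?n)) $ i" for i
      \<comment> \<open>Nonnegativity makes \<open>nat\<close> exact at both configurations.\<close>
      using v_nonneg[of j i] v_nonneg[of "Suc j" i] by (simp add: c_def) (simp add: v_def)
    ultimately show ?thesis unfolding step_def by blast
  qed
  ultimately show ?thesis by (rule non_terminatingI)
qed

lemma non_terminating_if_all_qrf_neutral:
  assumes "is_vass A" "strongly_connected A"
    and neutral: "\<And>g. qrf A g \<Longrightarrow> \<forall>t\<in>transitions A. neutral g t"
  shows "non_terminating A"
proof -
  have fin: "finite (transitions A)" and wf: "transitions A \<subseteq> states A \<times> UNIV \<times> states A"
    using assms(1) by (auto simp: is_vass_def)
  obtain x :: "_ \<Rightarrow> nat" where x: "\<And>t. t \<in> transitions A \<Longrightarrow> 1 \<le> x t"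
    "\<And>i. 0 \<le> (\<Sum>t\<in>transitions A. int (x t) * (eff t $ i))"
    "\<And>q. (\<Sum>t\<in>transitions A. x t * of_bool (dst t = q)) =
         (\<Sum>t\<in>transitions A. x t * of_bool (src t = q))"
    using ex_integral_multicycle[OF fin neutral] by blast
  obtain ts where ts: "ts \<noteq> []" "set ts \<subseteq> transitions A"
    "\<And>i. i < length ts \<Longrightarrow> dst (ts ! i) = src (ts ! (Suc i mod length ts))"
    "\<And>h :: _ \<Rightarrow> int. (\<Sum>i<length ts. h (ts ! i)) = (\<Sum>t\<in>transitions A. int (x t) * h t)"
    using ex_closed_walk[where x = x, OF assms(1,2) x(1,3)] by blast
  show ?thesis
    using non_terminating_if_closed_walk[OF wf ts(1-3)] ts(4)[of "\<lambda>t. eff t $ _"] x(2) by simp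
qed

section \<open>From the recursion of the algorithm to non-termination\<close>

lemma not_ranked_and_neutral: "\<not> (ranked g t \<and> neutral g t)"
  by (cases g; cases t) auto

text \<open>\<open>f\<close> ranks nothing, so by maximality no QRF ranks anything. Finiteness lets
  cardinality 0 mean the empty set.\<close>

lemma all_qrf_neutral_if_maximal_neutral:
  assumes fin: "finite (transitions A)"
    and f: "maximal_qrf A f" "neutral_trans A f = transitions A"
    and g: "qrf A g"
  shows "\<forall>t\<in>transitions A. neutral g t"
proof -
  have no_ranked: "{t \<in> transitions A. ranked f t} = {}"
    using f(2) not_ranked_and_neutral[of f] by (auto simp: neutral_trans_def)
  have "card {t \<in> transitions A. ranked g t} \<le> card {t \<in> transitions A. ranked f t}"
    using f(1) g unfolding maximal_qrf_def by blast
  then have "card {t \<in> transitions A. ranked g t} = 0"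
    unfolding no_ranked by simp
  moreover have "finite {t \<in> transitions A. ranked g t}" using fin by simp
  ultimately have "{t \<in> transitions A. ranked g t} = {}" by (simp only: card_0_eq)
  then show ?thesis using g unfolding qrf_def by blast
qed

lemma non_terminating_mono:
  assumes "non_terminating B" "states B \<subseteq> states A" "transitions B \<subseteq> transitions A"
  shows "non_terminating A"
proof -
  have "computation A cs" if "computation B cs" for cs
    using that assms(2,3) unfolding computation_def step_def by (meson subsetD)
  then have "max_length B c \<le> max_length A c" for c
    unfolding max_length_def by (intro Sup_subset_mono) blast
  then have "termination_complexity B n \<le> termination_complexity A n" for n
    unfolding termination_complexity_def using assms(2) by (intro Sup_mono) blast
  then show ?thesis using assms(1) unfolding non_terminating_def
    by (metis enat_ord_simps(5))
qed

text \<open>Makes the supremum over the SCCs a maximum that is attained.\<close>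

lemma finite_sccs_of_neutral:
  assumes "is_vass A"
  shows "finite (sccs_of_neutral A f)"
proof (rule inj_on_finite)
  show "inj_on (\<lambda>B. (states B, transitions B)) (sccs_of_neutral A f)"
    by (rule inj_onI) (auto intro: vass.equality)
  show "(\<lambda>B. (states B, transitions B)) ` sccs_of_neutral A f \<subseteq> Pow (states A) \<times> Pow (transitions A)"
    by (auto simp: sccs_of_neutral_def is_scc_def sub_vass_def neutral_trans_def)
  show "finite (Pow (states A) \<times> Pow (transitions A))"
    using assms by (simp add: is_vass_def)
qed

text \<open>The supremum of the empty set is 0, so \<open>S\<close> is nonempty and its supremum is
  its maximum.\<close>

lemma finite_Sup_enat_eq_infinity:
  assumes "finite S" "Sup S = (\<infinity> :: enat)"
  shows "\<infinity> \<in> S"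
proof -
  have "S \<noteq> {}" using assms(2) by (auto simp: bot_enat_def)
  then show ?thesis using assms Max_in[of S] by (simp add: Sup_enat_def)
qed

text \<open>An infinite result stems from some SCC with infinite result. SCCs are strongly connected
  sub-VASSs, so the induction hypothesis applies, and their computations are computations of
  \<open>A\<close>.\<close>

lemma non_terminating_if_decompose_infinity:
  assumes "decompose A k" "k = \<infinity>" "is_vass A" "strongly_connected A"
  shows "non_terminating A"
  using assms
proof (induction rule: decompose.induct)
  case (all_neutral A f)
  then have "finite (transitions A)" by (simp add: is_vass_def)
  then show ?case
    using non_terminating_if_all_qrf_neutral all_qrf_neutral_if_maximal_neutral all_neutral by blast
next
  case (recurse A f k)
  then have "(SUP B\<in>sccs_of_neutral A f. k B) = \<infinity>"
    by (metis enat_1_iff(1) infinity_ne_i1 plus_eq_infty_iff_enat)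
  then obtain B where B: "B \<in> sccs_of_neutral A f" "k B = \<infinity>"
    using finite_Sup_enat_eq_infinity finite_sccs_of_neutral recurse.prems(2)
    by (metis finite_imageI imageE)
  then have sub: "is_vass B" "strongly_connected B" "states B \<subseteq> states A" "transitions B \<subseteq> transitions A"
    by (auto simp: sccs_of_neutral_def is_scc_def sub_vass_def neutral_trans_def)
  then have "non_terminating B" using recurse.IH B by blast
  then show ?case using non_terminating_mono sub by blast
\<comment> \<open>The remaining case returns 1, which is finite.\<close>
qed (simp add: one_enat_def)

theorem mainTheorem4:
  fixes A :: "('q, 'd::finite) vass"
  assumes "is_vass A"
    and "strongly_connected A"
    and "transitions A \<noteq> {}"
    and "algorithm1 A Non_Terminating"
  shows "non_terminating A"
proof -
  obtain k where "decompose A k" "k = \<infinity>"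
    using assms(4) by (auto simp: algorithm1_def split: enat.splits)
  then show ?thesis using non_terminating_if_decompose_infinity assms(1,2) by blast
qed

end
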